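(* Consider the fully discretized anisotropic total variation regularized case described in the context. Assume that the iterate $\boldsymbol u_k^h:\Omega^h\to\mathbb{R}^l$ is sublabel-integral, i.e., $\boldsymbol u_k^h(x)\in\boldsymbol\Gamma$ for every $x\in\Omega^h$. Moreover, assume that $\boldsymbol p_k^h:=\nabla^\top\boldsymbol q_k^h$ is a subgradient in $\partial\boldsymbol J^h(\boldsymbol u_k^h)$, where $\boldsymbol q_k^h:\Omega^h\to\boldsymbol K_{\mathrm{an}}$ is a maximizer in the dual representation of $\boldsymbol J^h(\nabla\boldsymbol u_k^h)$, and define $\tilde{\boldsymbol q}_k^h$ pointwise by $$\tilde{\boldsymbol q}_k^h(x):=\frac{(\boldsymbol q_k^h(x))^i}{\gamma_{i+1}-\gamma_i}\,\tilde{\boldsymbol\gamma}\qquad\text{where }\boldsymbol u_k^h(x)=\boldsymbol 1_i^\alpha,$$ i.e., $\tilde{\boldsymbol q}_k^h(x)\in\mathbb{R}^{l\times d}$ is the matrix whose $j$-th row is $\frac{\gamma_{j+1}-\gamma_j}{\gamma_{i+1}-\gamma_i}(\boldsymbol q_k^h(x))^i$, with $(\boldsymbol q_k^h(x))^i\in\mathbb{R}^d$ the $i$-th row of $\boldsymbol q_k^h(x)$. Then $\tilde{\boldsymbol p}_k^h:=\nabla^\top\tilde{\boldsymbol q}_k^h$ is also a subgradient in $\partial\boldsymbol J^h(\boldsymbol u_k^h)$, and furthermore it is of the form $$\tilde{\boldsymbol p}_k^h=p_k^h\,\tilde{\boldsymbol\gamma},$$ where $p_k^h:\Omega^h\to\mathbb{R}$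 is a subgradient in the unlifted case, i.e., $p_k^h\in\partial J^h(u_k^h)$.
   Context: $\Omega^h$ is a finite discretized $d$-dimensional domain (grid) with grid spacing $h$; $\nabla$ is the discretized forward-difference operator on it (applied componentwise to vector-valued functions) and $\nabla^\top$ is its transpose. $\gamma_1<\dots<\gamma_L$ are real labels, $l=L-1$, $\Gamma=[\gamma_1,\gamma_L]$, and $\tilde{\boldsymbol\gamma}=(\gamma_2-\gamma_1,\dots,\gamma_L-\gamma_l)^\top\in\mathbb{R}^l$. For $i\in\{1,\dots,l\}$ and $\alpha\in[0,1]$, $\boldsymbol 1_i^\alpha=\alpha\boldsymbol 1_i+(1-\alpha)\boldsymbol 1_{i-1}\in\mathbb{R}^l$, where $\boldsymbol 1_i\in\mathbb{R}^l$ is the vector of $i$ ones followed by $l-i$ zeros; the lifted label space is $\boldsymbol\Gamma=\{\boldsymbol 1_i^\alpha:i\in\{1,\dots,l\},\alpha\in[0,1]\}$. The lifted anisotropic total variation of $\boldsymbol u^h:\Omega^h\to\mathbb{R}^l$ is given by the dual representation $$\boldsymbol J^h(\nabla\boldsymbol u^h)=\max_{\boldsymbol q^h:\Omega^h\to\boldsymbol K_{\mathrm{an}}}\ \sum_{x\in\Omega^h}\langle\boldsymbol q^h(x),\nabla\boldsymbol u^h(x)\rangle,$$ $$\boldsymbol K_{\mathrm{an}}=\{\boldsymbol q\in\mathbb{R}^{l\times d}:\|\boldsymbol q_i\|_\infty\le\gamma_{i+1}-\gamma_i\ \text{for all } i=1,\dots,l\},$$ where $\boldsymbol q_i\in\mathbb{R}^d$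 is the $i$-th row of $\boldsymbol q$. $\partial\boldsymbol J^h(\boldsymbol u^h)$ denotes the convex subdifferential of the map $\boldsymbol u^h\mapsto\boldsymbol J^h(\nabla\boldsymbol u^h)$ at $\boldsymbol u^h$. The unlifted regularizer is the anisotropic total variation $J^h(u^h)=\sum_{x\in\Omega^h}\|\nabla u^h(x)\|_1$ for $u^h:\Omega^h\to\mathbb{R}$, and $u_k^h$ is the unlifted function associated with $\boldsymbol u_k^h$ via $u_k^h(x)=\gamma_1+\sum_{i=1}^l(\boldsymbol u_k^h(x))^i(\gamma_{i+1}-\gamma_i)$. The product $p_k^h\,\tilde{\boldsymbol\gamma}$ is the function $x\mapsto p_k^h(x)\tilde{\boldsymbol\gamma}\in\mathbb{R}^l$.
   Formalization: At integral labels, where 1_i^1 = 1_{i+1}^0 gives two representations of u(x), the formula for q̃(x) is required to give the same value for both (q̃ well defined); otherwise q̃ is ambiguous, and the claim can fail for every choice of i. *)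

theory Defs
  imports "HOL-Analysis.Analysis"
begin

subsection \<open>Grids, forward differences and their transpose\<close>

definition is_grid :: "real \<Rightarrow> (real^'d) set \<Rightarrow> bool" where
  "is_grid h \<Omega> \<longleftrightarrow> h > 0 \<and> finite \<Omega> \<and>
     (\<exists>a. \<forall>x\<in>\<Omega>. \<forall>j. \<exists>k::int. x $ j = a $ j + h * of_int k)"

text \<open>
  A grid function is a total function of which only the values on \<open>\<Omega>\<close> matter.
  Differences that would leave the grid are zero (Neumann boundary condition).
\<close>

definition grad :: "real \<Rightarrow> (real^'d) set \<Rightarrow> (real^'d \<Rightarrow> real) \<Rightarrow> real^'d \<Rightarrow> real^'d" where
  "grad h \<Omega> u x =
     (\<chi> j. if x + h *\<^sub>R axis j 1 \<in> \<Omega> then (u (x + h *\<^sub>R axis j 1) - u x) / h else 0)"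

text \<open>
  The transposed matrix: the column of \<^const>\<open>grad\<close> that belongs to the grid point \<open>y\<close> is the
  gradient of the unit vector at \<open>y\<close>. The defining adjointness is lemma \<open>grad_adjoint\<close> below.
\<close>

definition grad_transpose ::
    "real \<Rightarrow> (real^'d) set \<Rightarrow> (real^'d \<Rightarrow> real^'d) \<Rightarrow> real^'d \<Rightarrow> real" where
  "grad_transpose h \<Omega> q y = (\<Sum>x\<in>\<Omega>. q x \<bullet> grad h \<Omega> (\<lambda>z. of_bool (z = y)) x)"

definition lifted_grad ::
    "real \<Rightarrow> (real^'d) set \<Rightarrow> (real^'d \<Rightarrow> real^'l) \<Rightarrow> real^'d \<Rightarrow> real^'d^'l" where
  "lifted_grad h \<Omega> u x = (\<chi> i. grad h \<Omega> (\<lambda>z. u z $ i) x)"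

definition lifted_grad_transpose ::
    "real \<Rightarrow> (real^'d) set \<Rightarrow> (real^'d \<Rightarrow> real^'d^'l) \<Rightarrow> real^'d \<Rightarrow> real^'l" where
  "lifted_grad_transpose h \<Omega> q x = (\<chi> i. grad_transpose h \<Omega> (\<lambda>z. q z $ i) x)"

definition grid_inner ::
    "'x set \<Rightarrow> ('x \<Rightarrow> 'a::real_inner) \<Rightarrow> ('x \<Rightarrow> 'a) \<Rightarrow> real" where
  "grid_inner \<Omega> f g = (\<Sum>x\<in>\<Omega>. f x \<bullet> g x)"

definition subdifferential ::
    "'x set \<Rightarrow> (('x \<Rightarrow> 'a::real_inner) \<Rightarrow> real) \<Rightarrow> ('x \<Rightarrow> 'a) \<Rightarrow> ('x \<Rightarrow> 'a) set" where
  "subdifferential \<Omega> F u = {p. \<forall>v. F u + grid_inner \<Omega> p (\<lambda>x. v x - u x) \<le> F v}"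


subsection \<open>Labels and the lifted label space\<close>

text \<open>
  The index set \<open>{1, \<dots>, l}\<close> is a finite linearly ordered type \<open>'l\<close>; \<open>index i\<close> is the number of
  the index \<open>i\<close>, counted from 1. The labels are \<open>\<gamma> 1 < \<dots> < \<gamma> (l + 1)\<close> with \<open>l = CARD('l)\<close>.
\<close>

definition index :: "'l::{finite,linorder} \<Rightarrow> nat" where
  "index i = card {..i}"

definition label_gaps :: "(nat \<Rightarrow> real) \<Rightarrow> real^'l::{finite,linorder}" where
  "label_gaps \<gamma> = (\<chi> i. \<gamma> (index i + 1) - \<gamma> (index i))"

definition ones :: "nat \<Rightarrow> real^'l::{finite,linorder}" where
  "ones n = (\<chi> j. if index j \<le> n then 1 else 0)"

definition sublabel :: "'l::{finite,linorder} \<Rightarrow> real \<Rightarrow> real^'l::{finite,linorder}" where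
  "sublabel i \<alpha> = \<alpha> *\<^sub>R ones (index i) + (1 - \<alpha>) *\<^sub>R ones (index i - 1)"

definition lifted_labels :: "(real^'l::{finite,linorder}) set" where
  "lifted_labels = {sublabel i \<alpha> | i \<alpha>. \<alpha> \<in> {0..1}}"

definition unlift :: "(nat \<Rightarrow> real) \<Rightarrow> ('x \<Rightarrow> real^'l::{finite,linorder}) \<Rightarrow> 'x \<Rightarrow> real" where
  "unlift \<gamma> u x = \<gamma> 1 + (\<Sum>i\<in>UNIV. u x $ i * label_gaps \<gamma> $ i)"


subsection \<open>Anisotropic total variation\<close>

definition K_an :: "(nat \<Rightarrow> real) \<Rightarrow> (real^'d^'l::{finite,linorder}) set" where
  "K_an \<gamma> = {q. \<forall>i. infnorm (q $ i) \<le> label_gaps \<gamma> $ i}"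

definition dual_fields ::
    "'x set \<Rightarrow> (nat \<Rightarrow> real) \<Rightarrow> ('x \<Rightarrow> real^'d^'l::{finite,linorder}) set" where
  "dual_fields \<Omega> \<gamma> = {q. \<forall>x\<in>\<Omega>. q x \<in> K_an \<gamma>}"

definition lifted_tv ::
    "real \<Rightarrow> (real^'d) set \<Rightarrow> (nat \<Rightarrow> real) \<Rightarrow> (real^'d \<Rightarrow> real^'l::{finite,linorder}) \<Rightarrow> real" where
  "lifted_tv h \<Omega> \<gamma> u = (SUP q\<in>dual_fields \<Omega> \<gamma>. grid_inner \<Omega> q (lifted_grad h \<Omega> u))"

definition tv :: "real \<Rightarrow> (real^'d) set \<Rightarrow> (real^'d \<Rightarrow> real) \<Rightarrow> real" where
  "tv h \<Omega> u = (\<Sum>x\<in>\<Omega>. \<Sum>j\<in>UNIV. \<bar>grad h \<Omega> u x $ j\<bar>)"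


text \<open>
  The row \<open>i\<close> of \<open>q x\<close> that is rescaled is the one with \<open>u x = 1\<^sub>i\<^sup>\<alpha>\<close>. At the integral labels
  \<open>1\<^sub>i\<^sup>1 = 1\<^sub>i\<^sub>+\<^sub>1\<^sup>0\<close> the pair \<open>(i, \<alpha>)\<close> is not unique; \<open>qt x\<close> is then required to obey the defining
  equation for both, i.e. the right-hand side must not depend on the representation of \<open>u x\<close>.
\<close>

definition is_rescaled_field ::
    "'x set \<Rightarrow> (nat \<Rightarrow> real) \<Rightarrow> ('x \<Rightarrow> real^'l::{finite,linorder}) \<Rightarrow>
     ('x \<Rightarrow> real^'d^'l::{finite,linorder}) \<Rightarrow> ('x \<Rightarrow> real^'d^'l::{finite,linorder}) \<Rightarrow> bool" where
  "is_rescaled_field \<Omega> \<gamma> u q qt \<longleftrightarrow>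
     (\<forall>x\<in>\<Omega>. \<forall>i. \<forall>\<alpha>\<in>{0..1}. u x = sublabel i \<alpha> \<longrightarrow>
        qt x = (\<chi> j. (label_gaps \<gamma> $ j / label_gaps \<gamma> $ i) *\<^sub>R (q x $ i)))"


lemma index_bij: "bij_betw (index::'l::{finite,linorder} \<Rightarrow> nat) UNIV {1..CARD('l)}"
proof -
  have m: "i < j \<Longrightarrow> index i < index j" for i j :: 'l
    unfolding index_def by (rule psubset_card_mono) auto
  have inj: "inj (index::'l \<Rightarrow> nat)"
    by (rule injI) (metis m less_irrefl linorder_neqE)
  have "range (index::'l \<Rightarrow> nat) \<subseteq> {1..CARD('l)}"
    by (auto simp: index_def Suc_le_eq card_gt_0_iff intro!: card_mono)
  then show ?thesis using inj
    by (simp add: bij_betw_def card_subset_eq card_image)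
qed

lemma grad_adjoint:
  assumes "finite \<Omega>"
  shows "grid_inner \<Omega> (grad_transpose h \<Omega> q) u = grid_inner \<Omega> q (grad h \<Omega> u)"
proof -
  have u: "(\<Sum>y\<in>\<Omega>. of_bool (z = y) * u y) = u z" if "z \<in> \<Omega>" for z
  proof -
    have "(\<Sum>y\<in>\<Omega>. of_bool (z = y) * u y) = (\<Sum>y\<in>\<Omega>. if z = y then u y else 0)"
      by (intro sum.cong) auto
    then show ?thesis using assms that by simp
  qed
  have g: "(\<Sum>y\<in>\<Omega>. grad h \<Omega> (\<lambda>z. of_bool (z = y)) x $ j * u y) = grad h \<Omega> u x $ j"
    if "x \<in> \<Omega>" for x j
    using u[OF that] u[of "x + h *\<^sub>R axis j 1"]
    by (simp add: grad_def left_diff_distrib sum_subtractf flip: sum_divide_distrib)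
  have "grid_inner \<Omega> (grad_transpose h \<Omega> q) u
      = (\<Sum>y\<in>\<Omega>. \<Sum>x\<in>\<Omega>. \<Sum>j\<in>UNIV. q x $ j * (grad h \<Omega> (\<lambda>z. of_bool (z = y)) x $ j * u y))"
    by (simp add: grid_inner_def grad_transpose_def inner_vec_def sum_distrib_right mult.assoc)
  also have "\<dots> = (\<Sum>x\<in>\<Omega>. \<Sum>j\<in>UNIV. \<Sum>y\<in>\<Omega>. q x $ j * (grad h \<Omega> (\<lambda>z. of_bool (z = y)) x $ j * u y))"
    by (subst sum.swap, rule sum.cong[OF refl], rule sum.swap)
  also have "\<dots> = grid_inner \<Omega> q (grad h \<Omega> u)"
    unfolding grid_inner_def inner_vec_def
    by (intro sum.cong refl) (simp add: g flip: sum_distrib_left)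
  finally show ?thesis .
qed

end

theory Submission
  imports Defs
begin

text \<open>
  A dual field maximizes exactly if every entry \<open>q i j\<close> equals the gap \<open>\<gamma> (i+1) - \<gamma> i\<close> times the sign
  of the corresponding difference of \<open>u\<close>, wherever that difference is nonzero. The lifted labels
  form a monotone chain, so along one edge of the grid all components of \<open>u\<close> change in the same
  direction, and if \<open>u\<close> changes at all, then the component \<open>i\<close> of some representation
  \<open>u x = 1\<^sub>i\<^sup>\<alpha>\<close> changes. Hence the rescaled row \<open>i\<close> carries the correct sign for all rows: the rescaled
  field is again a maximizer, and its common factor is a maximizer of the unlifted total variation.
\<close>

subsection \<open>The lifted labels as a monotone chain\<close>

lemma obtain_index:
  assumes "1 \<le> n" "n \<le> CARD('l)"
  obtains i :: "'l::{finite,linorder}" where "index i = n"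
  using assms index_bij[where 'l='l] by (metis atLeastAtMost_iff bij_betw_def imageE)

lemma index_bounds: "1 \<le> index (i::'l::{finite,linorder})" "index i \<le> CARD('l)"
  using index_bij[where 'l='l] by (auto simp: bij_betw_def)

text \<open>Parametrizes the lifted label space by one real number: for \<open>t\<close> in [0, l]
  the integer part counts the leading ones and the fractional part is the next entry. The two
  representations of an integral label receive the same \<open>t\<close>.\<close>

definition chain :: "real \<Rightarrow> real^'l::{finite,linorder}" where
  "chain t = (\<chi> j. max 0 (min 1 (t + 1 - real (index j))))"

lemma sublabel_eq_chain:
  assumes "\<alpha> \<in> {0..1}"
  shows "sublabel i \<alpha> = chain (real (index i) - 1 + \<alpha>)"
proof -
  have "sublabel i \<alpha> $ j = chain (real (index i) - 1 + \<alpha>) $ j" for j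
  proof (cases "index j" "index i" rule: linorder_cases)
    case less
    \<comment> \<open>Indices are integers, so distinct ones differ by at least 1; this saturates
      the clamp whatever the value of \<alpha>.\<close>
    then have "real (index j) + 1 \<le> real (index i)" by simp
    then show ?thesis using less assms by (simp add: sublabel_def ones_def chain_def)
  next
    case equal
    \<comment> \<open>Since \<open>index i\<close> is at least 1, the truncated
      \<open>index i - 1\<close> is strictly smaller, so \<open>ones (index i - 1)\<close> vanishes
      at \<open>i\<close>.\<close>
    then show ?thesis using assms index_bounds(1)[of i]
      by (auto simp: sublabel_def ones_def chain_def)
  next
    case greater
    then have "real (index i) + 1 \<le> real (index j)" by simp
    then show ?thesis using greater assms by (auto simp: sublabel_def ones_def chain_def)
  qed
  then show ?thesis by (simp add: vec_eq_iff)
qed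

lemma lifted_labels_chainE:
  assumes "a \<in> (lifted_labels :: (real^'l::{finite,linorder}) set)"
  obtains t where "0 \<le> t" "t \<le> real CARD('l)" "a = chain t"
proof -
  obtain i :: 'l and \<alpha> where a: "a = sublabel i \<alpha>" and \<alpha>: "\<alpha> \<in> {0..1}"
    using assms by (auto simp: lifted_labels_def)
  have "1 \<le> real (index i)" "real (index i) \<le> real CARD('l)"
    using index_bounds[of i] by simp_all
  then show ?thesis
    using a \<alpha> sublabel_eq_chain[OF \<alpha>, of i] by (intro that[of "real (index i) - 1 + \<alpha>"]) auto
qed

lemma chain_mono: "s \<le> t \<Longrightarrow> chain s $ j \<le> chain t $ j"
  by (auto simp: chain_def)

text \<open>
  At an integral label \<open>a\<close> the representation has to be chosen according to the direction of \<open>b\<close>: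
  \<open>\<alpha> = 0\<close> if \<open>b\<close> is above \<open>a\<close>, and \<open>\<alpha> = 1\<close> if it is below.
\<close>

lemma lifted_labels_direction:
  fixes a b :: "real^'l::{finite,linorder}"
  assumes a: "a \<in> lifted_labels" and b: "b \<in> lifted_labels" and ne: "a \<noteq> b"
  obtains i \<alpha> where "\<alpha> \<in> {0..1}" "a = sublabel i \<alpha>" "a $ i \<noteq> b $ i"
    "\<And>m. 0 \<le> (b $ m - a $ m) * (b $ i - a $ i)"
proof -
  obtain s where s: "0 \<le> s" "s \<le> real CARD('l)" "a = chain s"
    using lifted_labels_chainE[OF a] .
  obtain t where t: "0 \<le> t" "t \<le> real CARD('l)" "b = chain t"
    using lifted_labels_chainE[OF b] .
  consider "s < t" | "t < s" using ne s t by fastforce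
  then show ?thesis
  proof cases
    case 1
    \<comment> \<open>The first \<open>n\<close> entries of \<open>chain s\<close> are already 1;
      entry \<open>n + 1\<close> is the one that grows as soon as the parameter exceeds
      \<open>s\<close>. It exists because \<open>n \<le> s < t \<le> l\<close>.\<close>
    define n where "n = nat \<lfloor>s\<rfloor>"
    have n: "real n \<le> s" "s < real n + 1"
      using s(1) unfolding n_def by linarith+
    have "n + 1 \<le> CARD('l)" using 1 n t(2) by linarith
    then obtain i :: 'l where i: "index i = n + 1"
      using obtain_index[of "n + 1"] by auto
    have lt: "a $ i < b $ i" unfolding s(3) t(3) chain_def using i n 1 by auto
    have \<alpha>: "s - real n \<in> {0..1}" using n by auto
    show ?thesis
    proof (rule that[OF \<alpha>])
      show "a = sublabel i (s - real n)"
        unfolding sublabel_eq_chain[OF \<alpha>] using i s(3) by simp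
      show "0 \<le> (b $ m - a $ m) * (b $ i - a $ i)" for m
        using chain_mono[of s t m] 1 lt s(3) t(3) by simp
    qed (use lt in simp)
  next
    case 2
    \<comment> \<open>Rounding up instead picks the last nonzero entry, which drops first when the
      parameter decreases. It exists because \<open>0 \<le> t < s\<close>.\<close>
    define n where "n = nat \<lceil>s\<rceil>"
    have n: "s \<le> real n" "real n < s + 1"
      using s(1) unfolding n_def by linarith+
    have "1 \<le> n" "n \<le> CARD('l)" using 2 n s(2) t(1) by linarith+
    then obtain i :: 'l where i: "index i = n"
      using obtain_index[of "n"] by auto
    have lt: "b $ i < a $ i" unfolding s(3) t(3) chain_def using i n 2 by auto
    have \<alpha>: "s - real n + 1 \<in> {0..1}" using n by auto
    show ?thesis
    proof (rule that[OF \<alpha>])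
      show "a = sublabel i (s - real n + 1)"
        unfolding sublabel_eq_chain[OF \<alpha>] using i s(3) by simp
      show "0 \<le> (b $ m - a $ m) * (b $ i - a $ i)" for m
        using chain_mono[of t s m] 2 lt s(3) t(3) by (simp add: mult_nonpos_nonpos)
    qed (use lt in simp)
  qed
qed

lemma label_gaps_pos:
  fixes \<gamma> :: "nat \<Rightarrow> real"
  assumes "strict_mono_on {1..CARD('l::{finite,linorder}) + 1} \<gamma>"
  shows "0 < label_gaps \<gamma> $ (i::'l)"
  using strict_mono_onD[OF assms, of "index i" "index i + 1"] index_bounds[of i]
  by (simp add: label_gaps_def)


subsection \<open>Duality\<close>

lemma lifted_grad_adjoint:
  assumes "finite \<Omega>"
  shows "grid_inner \<Omega> (lifted_grad_transpose h \<Omega> q) u = grid_inner \<Omega> q (lifted_grad h \<Omega> u)"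
proof -
  have "grid_inner \<Omega> (lifted_grad_transpose h \<Omega> q) u =
      (\<Sum>i\<in>UNIV. grid_inner \<Omega> (grad_transpose h \<Omega> (\<lambda>z. q z $ i)) (\<lambda>z. u z $ i))"
    by (simp add: grid_inner_def inner_vec_def lifted_grad_transpose_def) (rule sum.swap)
  also have "\<dots> = (\<Sum>i\<in>UNIV. grid_inner \<Omega> (\<lambda>z. q z $ i) (grad h \<Omega> (\<lambda>z. u z $ i)))"
    by (simp add: grad_adjoint[OF assms])
  also have "\<dots> = grid_inner \<Omega> q (lifted_grad h \<Omega> u)"
    unfolding grid_inner_def inner_vec_def[of "q _"] lifted_grad_def by simp (rule sum.swap)
  finally show ?thesis .
qed

text \<open>The pairing is linear, so the value at \<open>u\<close> cancels in the subgradient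
  inequality. This turns maximizing dual fields into subgradients, in the lifted and in the unlifted
  case.\<close>

lemma subdifferentialI:
  assumes "\<And>v. grid_inner \<Omega> p v \<le> F v" and "grid_inner \<Omega> p u = F u"
  shows "p \<in> subdifferential \<Omega> F u"
proof -
  have "grid_inner \<Omega> p (\<lambda>x. v x - u x) = grid_inner \<Omega> p v - grid_inner \<Omega> p u" for v
    by (simp add: grid_inner_def inner_diff_right sum_subtractf)
  then show ?thesis using assms by (simp add: subdifferential_def)
qed

section \<open>Entrywise form of the dual ball and closed form of the lifted total variation\<close>

lemma infnorm_cart_le_iff:
  fixes x :: "real^'n"
  shows "infnorm x \<le> c \<longleftrightarrow> (\<forall>j. \<bar>x $ j\<bar> \<le> c)"
proof
  show "infnorm x \<le> c \<Longrightarrow> \<forall>j. \<bar>x $ j\<bar> \<le> c"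
    using component_le_infnorm_cart[of x] order_trans by blast
  show "\<forall>j. \<bar>x $ j\<bar> \<le> c \<Longrightarrow> infnorm x \<le> c"
    unfolding infnorm_cart by (rule cSup_least) auto
qed

lemma mem_K_an_iff: "q \<in> K_an \<gamma> \<longleftrightarrow> (\<forall>i j. \<bar>q $ i $ j\<bar> \<le> label_gaps \<gamma> $ i)"
  by (simp add: K_an_def infnorm_cart_le_iff)

lemma mult_le_bound_abs: "\<bar>a\<bar> \<le> c \<Longrightarrow> a * b \<le> c * \<bar>b\<bar>" for a b c :: real
  using abs_ge_self[of "a * b"] mult_right_mono[of "\<bar>a\<bar>" c "\<bar>b\<bar>"] by (simp add: abs_mult)

text \<open>The closed form of \<open>lifted_tv\<close>: the constraint \<open>K_an\<close> bounds
  each entry separately, so the maximization decouples over grid points, rows and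
  directions.\<close>

definition weighted_tv ::
    "real \<Rightarrow> (real^'d) set \<Rightarrow> (nat \<Rightarrow> real) \<Rightarrow> (real^'d \<Rightarrow> real^'l::{finite,linorder}) \<Rightarrow> real" where
  "weighted_tv h \<Omega> \<gamma> u =
     (\<Sum>x\<in>\<Omega>. \<Sum>i\<in>UNIV. \<Sum>j\<in>UNIV. label_gaps \<gamma> $ i * \<bar>lifted_grad h \<Omega> u x $ i $ j\<bar>)"

lemma grid_inner_matrix:
  "grid_inner \<Omega> q (g :: 'x \<Rightarrow> real^'d^'l) = (\<Sum>x\<in>\<Omega>. \<Sum>i\<in>UNIV. \<Sum>j\<in>UNIV. q x $ i $ j * g x $ i $ j)"
  by (simp add: grid_inner_def inner_vec_def)

lemma dual_field_le_weighted_tv: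
  assumes "q \<in> dual_fields \<Omega> \<gamma>"
  shows "grid_inner \<Omega> q (lifted_grad h \<Omega> u) \<le> weighted_tv h \<Omega> \<gamma> u"
  unfolding grid_inner_matrix weighted_tv_def using assms
  by (intro sum_mono mult_le_bound_abs) (auto simp: dual_fields_def mem_K_an_iff)

lemma weighted_tv_attained:
  fixes u :: "real^'d \<Rightarrow> real^'l::{finite,linorder}"
  assumes "\<And>i::'l. 0 \<le> label_gaps \<gamma> $ i"
  obtains q where "q \<in> dual_fields \<Omega> \<gamma>"
    "grid_inner \<Omega> q (lifted_grad h \<Omega> u) = weighted_tv h \<Omega> \<gamma> u"
proof -
  \<comment> \<open>Each entry takes its extreme value with the sign of the difference, and the
    admissible value 0 where the difference vanishes.\<close>
  let ?q = "\<lambda>x. (\<chi> i j. label_gaps \<gamma> $ i * sgn (lifted_grad h \<Omega> u x $ i $ j)) :: real^'d^'l::{finite,linorder}"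
  have "\<bar>label_gaps \<gamma> $ i * sgn c\<bar> \<le> label_gaps \<gamma> $ i" for i :: 'l and c :: real
    using assms[of i] by (simp add: sgn_if)
  then have "?q \<in> dual_fields \<Omega> \<gamma>"
    by (auto simp: dual_fields_def mem_K_an_iff)
  moreover have "grid_inner \<Omega> ?q (lifted_grad h \<Omega> u) = weighted_tv h \<Omega> \<gamma> u"
    unfolding grid_inner_matrix weighted_tv_def
    by (intro sum.cong refl) (simp add: mult.assoc abs_sgn mult.commute[of "sgn _"])
  ultimately show ?thesis by (rule that)
qed

lemma lifted_tv_eq_weighted_tv:
  fixes u :: "real^'d \<Rightarrow> real^'l::{finite,linorder}"
  assumes "\<And>i::'l. 0 \<le> label_gaps \<gamma> $ i"
  shows "lifted_tv h \<Omega> \<gamma> u = weighted_tv h \<Omega> \<gamma> u"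
  unfolding lifted_tv_def
  by (rule cSup_eq_maximum)
    (metis weighted_tv_attained[OF assms] image_eqI, auto intro: dual_field_le_weighted_tv)

text \<open>Complementary slackness: two finite sums ordered term by term can only have equal totals
  if every pair of terms agrees.\<close>

lemma maximizer_pointwise:
  fixes u :: "real^'d \<Rightarrow> real^'l::{finite,linorder}"
  assumes fin: "finite \<Omega>" and gaps: "\<And>i::'l. 0 \<le> label_gaps \<gamma> $ i"
    and q: "q \<in> dual_fields \<Omega> \<gamma>"
    and max: "weighted_tv h \<Omega> \<gamma> u \<le> grid_inner \<Omega> q (lifted_grad h \<Omega> u)"
    and x: "x \<in> \<Omega>"
  shows "q x $ i $ j * lifted_grad h \<Omega> u x $ i $ j = label_gaps \<gamma> $ i * \<bar>lifted_grad h \<Omega> u x $ i $ j\<bar>"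
proof -
  let ?f = "\<lambda>x i j. q x $ i $ j * lifted_grad h \<Omega> u x $ i $ j"
  let ?g = "\<lambda>x i j. label_gaps \<gamma> $ i * \<bar>lifted_grad h \<Omega> u x $ i $ j\<bar>"
  have le: "?f x i j \<le> ?g x i j" if "x \<in> \<Omega>" for x i j
    using q that by (intro mult_le_bound_abs) (auto simp: dual_fields_def mem_K_an_iff)
  have "(\<Sum>x\<in>\<Omega>. \<Sum>i\<in>UNIV. \<Sum>j\<in>UNIV. ?f x i j) = (\<Sum>x\<in>\<Omega>. \<Sum>i\<in>UNIV. \<Sum>j\<in>UNIV. ?g x i j)"
    using max dual_field_le_weighted_tv[OF q] by (simp add: grid_inner_matrix weighted_tv_def order_antisym)
  \<comment> \<open>The three nested sums are peeled off one at a time, from the outside in.\<close>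
  then have "(\<Sum>i\<in>UNIV. \<Sum>j\<in>UNIV. ?f x i j) = (\<Sum>i\<in>UNIV. \<Sum>j\<in>UNIV. ?g x i j)"
    by (rule sum_mono_inv) (use fin x in \<open>auto intro!: sum_mono le\<close>)
  then have "(\<Sum>j\<in>UNIV. ?f x i j) = (\<Sum>j\<in>UNIV. ?g x i j)"
    by (rule sum_mono_inv) (use x in \<open>auto intro!: sum_mono le\<close>)
  then show ?thesis
    by (rule sum_mono_inv) (use x in \<open>auto intro!: le\<close>)
qed

section \<open>Differences of the unlifted function and the sign of the rescaled row\<close>

lemma grad_unlift:
  "grad h \<Omega> (unlift \<gamma> u) x $ j = (\<Sum>m\<in>UNIV. label_gaps \<gamma> $ m * lifted_grad h \<Omega> u x $ m $ j)"
  \<comment> \<open>The offset \<open>\<gamma> 1\<close> cancels in the difference; where the edge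
    leaves the grid, both sides are 0.\<close>
  by (simp add: grad_def lifted_grad_def unlift_def sum_divide_distrib
      flip: sum_subtractf) (simp add: algebra_simps)

lemma dual_field_le_tv:
  assumes "\<And>x j. x \<in> \<Omega> \<Longrightarrow> \<bar>s x $ j\<bar> \<le> 1"
  shows "grid_inner \<Omega> s (grad h \<Omega> v) \<le> tv h \<Omega> v"
  unfolding grid_inner_def tv_def inner_vec_def
  by (intro sum_mono) (use mult_le_bound_abs[OF assms] in simp)

text \<open>The hypothesis on \<open>s\<close> covers every representation of \<open>u x\<close>: at
  an integral label with two representations, only one of the two rows changes along a given edge,
  and the direction of the change decides which. The neighbour must be a lifted label too, hence
  \<open>integral\<close> on the whole grid.\<close>

lemma rescaled_row_sign:
  fixes u :: "real^'d \<Rightarrow> real^'l::{finite,linorder}" and q :: "real^'d \<Rightarrow> real^'d^'l::{finite,linorder}"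
  assumes h: "0 < h" and x: "x \<in> \<Omega>"
    and gaps: "\<And>i::'l. 0 < label_gaps \<gamma> $ i"
    and integral: "\<And>x. x \<in> \<Omega> \<Longrightarrow> u x \<in> lifted_labels"
    and max: "\<And>i. q x $ i $ j * lifted_grad h \<Omega> u x $ i $ j =
      label_gaps \<gamma> $ i * \<bar>lifted_grad h \<Omega> u x $ i $ j\<bar>"
    and s: "\<And>i \<alpha>. \<alpha> \<in> {0..1} \<Longrightarrow> u x = sublabel i \<alpha> \<Longrightarrow> q x $ i $ j = label_gaps \<gamma> $ i * s"
  shows "s * lifted_grad h \<Omega> u x $ m $ j = \<bar>lifted_grad h \<Omega> u x $ m $ j\<bar>"
proof (cases "x + h *\<^sub>R axis j 1 \<in> \<Omega> \<and> u x \<noteq> u (x + h *\<^sub>R axis j 1)")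
  case False
  then have "lifted_grad h \<Omega> u x $ m $ j = 0"
    by (auto simp: lifted_grad_def grad_def)
  then show ?thesis by simp
next
  case True
  define y where "y = x + h *\<^sub>R axis j 1"
  have g: "lifted_grad h \<Omega> u x $ k $ j = (u y $ k - u x $ k) / h" for k
    using True by (simp add: lifted_grad_def grad_def y_def)
  obtain i \<alpha> where i: "\<alpha> \<in> {0..1}" "u x = sublabel i \<alpha>" "u x $ i \<noteq> u y $ i"
    and dir: "\<And>m. 0 \<le> (u y $ m - u x $ m) * (u y $ i - u x $ i)"
  proof (rule lifted_labels_direction[of "u x" "u y"])
    show "u x \<in> lifted_labels" "u y \<in> lifted_labels" "u x \<noteq> u y"
      using integral x True by (auto simp: y_def)
  qed (rule that)
  \<comment> \<open>Maximality in row \<open>i\<close>, with the positive factors gap and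
    \<open>h\<close> cancelled.\<close>
  have "s * (u y $ i - u x $ i) = \<bar>u y $ i - u x $ i\<bar>"
    using max[of i] gaps[of i] h unfolding s[OF i(1,2)] g by (simp add: mult.assoc)
  then have "s = sgn (u y $ i - u x $ i)"
    using i(3) by (metis abs_sgn mult.commute mult_right_cancel right_minus_eq)
  \<comment> \<open>By \<open>dir\<close>, row \<open>m\<close> either does not change or changes in
    the direction of row \<open>i\<close>.\<close>
  moreover have "sgn (u y $ i - u x $ i) * (u y $ m - u x $ m) = \<bar>u y $ m - u x $ m\<bar>"
    using dir[of m] i(3) by (auto simp: sgn_if abs_if zero_le_mult_iff)
  ultimately show ?thesis using h by (simp add: g)
qed

section \<open>Subgradients from the rescaled field\<close>

theorem proposition4:
  fixes h :: real
    and \<Omega> :: "(real^'d) set"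
    and \<gamma> :: "nat \<Rightarrow> real"
    and u :: "real^'d \<Rightarrow> real^'l::{finite,linorder}"
    and q qt :: "real^'d \<Rightarrow> real^'d^'l::{finite,linorder}"
  assumes grid: "is_grid h \<Omega>"
    and labels: "strict_mono_on {1..CARD('l) + 1} \<gamma>"
    and sublabel_integral: "\<forall>x\<in>\<Omega>. u x \<in> lifted_labels"
    and maximizer: "is_arg_max (\<lambda>q'. grid_inner \<Omega> q' (lifted_grad h \<Omega> u))
                      (\<lambda>q'. q' \<in> dual_fields \<Omega> \<gamma>) q"
    and subgradient: "lifted_grad_transpose h \<Omega> q \<in> subdifferential \<Omega> (lifted_tv h \<Omega> \<gamma>) u"
    and rescaled: "is_rescaled_field \<Omega> \<gamma> u q qt"
  shows "lifted_grad_transpose h \<Omega> qt \<in> subdifferential \<Omega> (lifted_tv h \<Omega> \<gamma>) u \<and>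
         (\<exists>p. (\<forall>x\<in>\<Omega>. lifted_grad_transpose h \<Omega> qt x = p x *\<^sub>R label_gaps \<gamma>) \<and>
              p \<in> subdifferential \<Omega> (tv h \<Omega>) (unlift \<gamma> u))"
proof -
  have fin: "finite \<Omega>" and h: "0 < h" using grid by (auto simp: is_grid_def)
  have gaps: "0 < label_gaps \<gamma> $ i" for i :: 'l using label_gaps_pos[OF labels] .
  then have gaps0: "0 \<le> label_gaps \<gamma> $ i" for i :: 'l by (simp add: less_imp_le)
  have q: "q \<in> dual_fields \<Omega> \<gamma>"
    using maximizer by (simp add: is_arg_max_linorder)
  \<comment> \<open>Some admissible field attains the closed form, so the maximizer \<open>q\<close>
    reaches it as well.\<close>
  obtain q' where "q' \<in> dual_fields \<Omega> \<gamma>"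
    "grid_inner \<Omega> q' (lifted_grad h \<Omega> u) = weighted_tv h \<Omega> \<gamma> u"
    using weighted_tv_attained[OF gaps0] .
  then have "weighted_tv h \<Omega> \<gamma> u \<le> grid_inner \<Omega> q (lifted_grad h \<Omega> u)"
    using maximizer by (metis is_arg_max_linorder)
  note pointwise = maximizer_pointwise[OF fin gaps0 q this]

  \<comment> \<open>Dividing an arbitrary fixed row of \<open>qt x\<close> by its gap recovers the
    common factor \<open>s x\<close> without choosing a representation of \<open>u x\<close>; thus
    \<open>s x\<close> agrees with the normalized row \<open>i\<close> of \<open>q x\<close> for
    every representation.\<close>
  define i0 :: 'l where "i0 = undefined"
  define s where "s x = qt x $ i0 /\<^sub>R label_gaps \<gamma> $ i0" for x
  have s: "s x = q x $ i /\<^sub>R label_gaps \<gamma> $ i"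
    and qt: "qt x $ m = label_gaps \<gamma> $ m *\<^sub>R s x"
    if "x \<in> \<Omega>" "\<alpha> \<in> {0..1}" "u x = sublabel i \<alpha>" for x i m \<alpha>
  proof -
    have *: "qt x $ m = (label_gaps \<gamma> $ m / label_gaps \<gamma> $ i) *\<^sub>R (q x $ i)" for m
      using rescaled[unfolded is_rescaled_field_def, rule_format, OF that] by simp
    show "s x = q x $ i /\<^sub>R label_gaps \<gamma> $ i"
      using gaps[of i0] by (simp add: s_def * field_simps)
    then show "qt x $ m = label_gaps \<gamma> $ m *\<^sub>R s x"
      by (simp add: * divide_inverse)
  qed
  have rep: "\<exists>i \<alpha>. \<alpha> \<in> {0..1} \<and> u x = sublabel i \<alpha>" if "x \<in> \<Omega>" for x
    using sublabel_integral that unfolding lifted_labels_def by blast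
  have qt_s: "qt x $ m = label_gaps \<gamma> $ m *\<^sub>R s x" if "x \<in> \<Omega>" for x m
    using rep[OF that] qt[OF that] by blast
  \<comment> \<open>A row of an admissible field divided by its gap lies in the sup-norm unit ball,
    the dual ball of the unlifted total variation.\<close>
  have s_le: "\<bar>s x $ j\<bar> \<le> 1" if x: "x \<in> \<Omega>" for x j
  proof -
    obtain i \<alpha> where i: "\<alpha> \<in> {0..1}" "u x = sublabel i \<alpha>" using rep[OF x] by blast
    have "\<bar>q x $ i $ j\<bar> \<le> label_gaps \<gamma> $ i"
      using q x by (auto simp: dual_fields_def mem_K_an_iff)
    then show ?thesis
      using gaps[of i] by (simp add: s[OF x i] abs_mult field_simps)
  qed
  have sign: "s x $ j * lifted_grad h \<Omega> u x $ m $ j = \<bar>lifted_grad h \<Omega> u x $ m $ j\<bar>"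
    if x: "x \<in> \<Omega>" for x j m
  proof (rule rescaled_row_sign[OF h x gaps])
    show "q x $ i $ j * lifted_grad h \<Omega> u x $ i $ j =
        label_gaps \<gamma> $ i * \<bar>lifted_grad h \<Omega> u x $ i $ j\<bar>" for i
      using pointwise[OF x] .
    show "q x $ i $ j = label_gaps \<gamma> $ i * s x $ j"
      if "\<alpha> \<in> {0..1}" "u x = sublabel i \<alpha>" for i \<alpha>
      using s[OF x that] gaps[of i] by simp
  qed (use sublabel_integral in blast)

  \<comment> \<open>Multiplying \<open>s\<close> by the gap of each row restores the bounds of
    \<open>K_an\<close>, and \<open>sign\<close> makes every term extremal.\<close>
  have "qt \<in> dual_fields \<Omega> \<gamma>"
    using s_le gaps0 by (auto simp: dual_fields_def mem_K_an_iff qt_s abs_mult mult_left_le)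
  moreover have "grid_inner \<Omega> qt (lifted_grad h \<Omega> u) = weighted_tv h \<Omega> \<gamma> u"
    unfolding grid_inner_matrix weighted_tv_def
    by (intro sum.cong refl) (simp add: qt_s sign mult.assoc)
  ultimately have lifted:
    "lifted_grad_transpose h \<Omega> qt \<in> subdifferential \<Omega> (lifted_tv h \<Omega> \<gamma>) u"
    by (intro subdifferentialI)
      (simp_all add: lifted_grad_adjoint[OF fin] lifted_tv_eq_weighted_tv[OF gaps0]
        dual_field_le_weighted_tv)

  \<comment> \<open>The transpose only sums over grid points, where \<open>qt\<close> factors
    through \<open>s\<close>, so the identity holds for every \<open>x\<close>.\<close>
  have product: "lifted_grad_transpose h \<Omega> qt x = grad_transpose h \<Omega> s x *\<^sub>R label_gaps \<gamma>" for x
    by (simp add: vec_eq_iff lifted_grad_transpose_def grad_transpose_def qt_s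
        flip: sum_distrib_left)

  have "s x $ j * grad h \<Omega> (unlift \<gamma> u) x $ j = \<bar>grad h \<Omega> (unlift \<gamma> u) x $ j\<bar>"
    if x: "x \<in> \<Omega>" for x j
  proof (rule antisym)
    show "s x $ j * grad h \<Omega> (unlift \<gamma> u) x $ j \<le> \<bar>grad h \<Omega> (unlift \<gamma> u) x $ j\<bar>"
      using mult_le_bound_abs[OF s_le[OF x]] by simp
    \<comment> \<open>The triangle inequality loses nothing here: by \<open>sign\<close>, each
      absolute value is the signed difference times the same factor \<open>s x $ j\<close>.\<close>
    have "\<bar>grad h \<Omega> (unlift \<gamma> u) x $ j\<bar> \<le>
        (\<Sum>m\<in>UNIV. label_gaps \<gamma> $ m * \<bar>lifted_grad h \<Omega> u x $ m $ j\<bar>)"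
      unfolding grad_unlift by (rule sum_abs[THEN order_trans]) (simp add: abs_mult gaps0)
    also have "\<dots> = s x $ j * grad h \<Omega> (unlift \<gamma> u) x $ j"
      unfolding grad_unlift sum_distrib_left
      by (intro sum.cong refl) (simp add: sign[OF x, symmetric])
    finally show "\<bar>grad h \<Omega> (unlift \<gamma> u) x $ j\<bar> \<le> s x $ j * grad h \<Omega> (unlift \<gamma> u) x $ j" .
  qed
  then have "grid_inner \<Omega> s (grad h \<Omega> (unlift \<gamma> u)) = tv h \<Omega> (unlift \<gamma> u)"
    by (simp add: grid_inner_def tv_def inner_vec_def)
  \<comment> \<open>The transpose of the common factor \<open>s\<close> is the witness for the
    unlifted subgradient.\<close>
  then have "grad_transpose h \<Omega> s \<in> subdifferential \<Omega> (tv h \<Omega>) (unlift \<gamma> u)"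
    by (intro subdifferentialI) (simp_all add: grad_adjoint[OF fin] dual_field_le_tv[OF s_le])
  then show ?thesis using lifted product by blast
qed

end
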